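(* Let $\mathcal{S}_{C^0}(T\mathbb{S}^1)$ be the Banach space of (tangential) continuous vector fields on $\mathbb{S}^1$ and $\mathcal{S}_{C^0}(T\mathbb{D})$ the space of continuous vector fields on the open disk $\mathbb{D}$. A linear map $$\mathcal{F}:\mathcal{S}_{C^0}(T\mathbb{S}^1)\to\mathcal{S}_{C^0}(T\mathbb{D})$$ is given by the normalized convolution $\mathcal{F}(X)=f*\mathbf{K}$, where $X=fY$ with $f$ a real-valued continuous function on $\mathbb{S}^1$ and $Y(z)=iz$, and where $\mathbf{K}$ is the Poisson kernel vector field $$\mathbf{K}(z)=\frac{i(1-|z|^2)^3}{|1-\bar z|^2\,(1-\bar z)^2}.$$ Moreover, $\mathcal{F}(X)$ is a harmonic vector field on the open unit disk $\mathbb{D}$.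
   Context: Vector fields are identified with $\mathbb{C}$-valued functions. Every continuous tangential vector field $X$ on $\mathbb{S}^1$ is uniquely $X=fY$ with $f$ real-valued continuous and $Y(z)=iz$. The normalized convolution of $f$ with the vector field $\mathbf{K}$ is the average of the rotated copies of $\mathbf{K}$ (rotated as vector fields) weighted by $f$: $$(f*\mathbf{K})(z)=\frac1{2\pi}\int_{\mathbb{S}^1}f(w)\,w\,\mathbf{K}(zw^{-1})\,dw,$$ where $dw$ is arc length on $\mathbb{S}^1$ (total mass $2\pi$). $\mathbb{D}$ carries $\mathbf{g}_{\mathbb{D}}=4(dx^2+dy^2)/(1-|z|^2)^2$. Harmonic vector field: for a smooth map $\phi:U\to \mathbb{D}$ from an open set $U\subseteq \mathbb{D}$, the tension field is $\tau(\phi)=\mathrm{trace}(\nabla d\phi)$, with $\nabla$ the connection on $T^*U\otimes\phi^{-1}T\mathbb{D}$ induced by the Levi-Civita connections. A smooth vector field $\xi$ on $U$ is harmonic if there is a smooth family of smooth maps $\phi_t:U\to \mathbb{D}$, $t\in[0,\epsilon)$, such that $\phi_0$ is the inclusion, $\frac{d\phi_t}{dt}|_{t=0}=\xi$, and $\frac{d}{dt}|_{t=0}\tau(\phi_t)(x)=0$ for all $x\in U$ (computed in the standard coordinates of $\mathbb{C}$). *)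

theory Defs
  imports "HOL-Analysis.Analysis"
begin

section \<open>Continuous vector fields on the circle and on the disk\<close>

text \<open>
  Vector fields are complex-valued functions. A field on the circle or on the disk is represented
  by the function on the whole plane that vanishes elsewhere, so that equality of representatives
  is equality of fields.
\<close>

typedef circle_field =
  "{X :: complex \<Rightarrow> complex. continuous_on (sphere 0 1) X \<and>
      (\<forall>z\<in>sphere 0 1. X z \<bullet> z = 0) \<and> (\<forall>z. z \<notin> sphere 0 1 \<longrightarrow> X z = 0)}"
  morphisms circle_field_at Circle_field
  by (rule exI[of _ "\<lambda>_. 0"]) auto

typedef disk_field =
  "{\<xi> :: complex \<Rightarrow> complex. continuous_on (ball 0 1) \<xi> \<and> (\<forall>z. z \<notin> ball 0 1 \<longrightarrow> \<xi> z = 0)}"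
  morphisms disk_field_at Disk_field
  by (rule exI[of _ "\<lambda>_. 0"]) auto

setup_lifting type_definition_circle_field
setup_lifting type_definition_disk_field

lemma circle_field_eqI: "(\<And>z. circle_field_at X z = circle_field_at X' z) \<Longrightarrow> X = X'"
  by transfer auto

lemma disk_field_eqI: "(\<And>z. disk_field_at \<xi> z = disk_field_at \<xi>' z) \<Longrightarrow> \<xi> = \<xi>'"
  by transfer auto

instantiation circle_field :: real_vector
begin

lift_definition zero_circle_field :: circle_field is "\<lambda>_. 0" by auto
lift_definition uminus_circle_field :: "circle_field \<Rightarrow> circle_field" is "\<lambda>X z. - X z"
  by (auto intro: continuous_intros)
lift_definition plus_circle_field :: "circle_field \<Rightarrow> circle_field \<Rightarrow> circle_field"
  is "\<lambda>X X' z. X z + X' z"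
  by (auto intro: continuous_intros simp: inner_add_left)
lift_definition minus_circle_field :: "circle_field \<Rightarrow> circle_field \<Rightarrow> circle_field"
  is "\<lambda>X X' z. X z - X' z"
  by (auto intro: continuous_intros simp: inner_diff_left)
lift_definition scaleR_circle_field :: "real \<Rightarrow> circle_field \<Rightarrow> circle_field"
  is "\<lambda>a X z. a *\<^sub>R X z"
  by (auto intro: continuous_intros)

instance
  by standard (transfer; simp add: algebra_simps)+

end

instantiation disk_field :: real_vector
begin

lift_definition zero_disk_field :: disk_field is "\<lambda>_. 0" by auto
lift_definition uminus_disk_field :: "disk_field \<Rightarrow> disk_field" is "\<lambda>\<xi> z. - \<xi> z"
  by (auto intro: continuous_intros)
lift_definition plus_disk_field :: "disk_field \<Rightarrow> disk_field \<Rightarrow> disk_field"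
  is "\<lambda>\<xi> \<xi>' z. \<xi> z + \<xi>' z"
  by (auto intro: continuous_intros)
lift_definition minus_disk_field :: "disk_field \<Rightarrow> disk_field \<Rightarrow> disk_field"
  is "\<lambda>\<xi> \<xi>' z. \<xi> z - \<xi>' z"
  by (auto intro: continuous_intros)
lift_definition scaleR_disk_field :: "real \<Rightarrow> disk_field \<Rightarrow> disk_field"
  is "\<lambda>a \<xi> z. a *\<^sub>R \<xi> z"
  by (auto intro: continuous_intros)

instance
  by standard (transfer; simp add: algebra_simps)+

end

lemma sphere_0_1_ne [simp]: "sphere (0::complex) 1 \<noteq> {}"
  using norm_one[where 'a = complex] by (metis empty_iff mem_sphere_0)

lemma bdd_above_norm_circle_field:
  "bdd_above ((\<lambda>z. norm (circle_field_at X z)) ` sphere 0 1)"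
proof -
  have "continuous_on (sphere 0 1) (circle_field_at X)"
    by transfer auto
  then have "compact ((\<lambda>z. norm (circle_field_at X z)) ` sphere 0 1)"
    by (intro compact_continuous_image continuous_intros) auto
  then show ?thesis
    by (intro bounded_imp_bdd_above compact_imp_bounded)
qed

instantiation circle_field :: real_normed_vector
begin

definition norm_circle_field :: "circle_field \<Rightarrow> real"
  where "norm_circle_field X = (SUP z\<in>sphere 0 1. norm (circle_field_at X z))"

definition dist_circle_field :: "circle_field \<Rightarrow> circle_field \<Rightarrow> real"
  where "dist_circle_field X X' = norm (X - X')"

definition sgn_circle_field :: "circle_field \<Rightarrow> circle_field"
  where "sgn_circle_field X = X /\<^sub>R norm X"

definition uniformity_circle_field :: "(circle_field \<times> circle_field) filter"
  where "uniformity_circle_field = (INF e\<in>{0 <..}. principal {(X, X'). dist X X' < e})"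

definition open_circle_field :: "circle_field set \<Rightarrow> bool"
  where "open_circle_field S = (\<forall>X\<in>S. \<forall>\<^sub>F (X', Y) in uniformity. X' = X \<longrightarrow> Y \<in> S)"

lemma norm_circle_field_at_le: "norm (circle_field_at X z) \<le> norm X"
proof (cases "z \<in> sphere 0 1")
  case True
  then show ?thesis
    unfolding norm_circle_field_def
    by (intro cSUP_upper bdd_above_norm_circle_field)
next
  case False
  then have "circle_field_at X z = 0"
    by transfer auto
  moreover have "norm (circle_field_at X 1) \<le> norm X"
    unfolding norm_circle_field_def
    by (intro cSUP_upper bdd_above_norm_circle_field) auto
  then have "0 \<le> norm X"
    using norm_ge_zero order_trans by blast
  ultimately show ?thesis
    by simp
qed

lemma norm_circle_field_leI: "(\<And>z. norm (circle_field_at X z) \<le> b) \<Longrightarrow> norm X \<le> b"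
  unfolding norm_circle_field_def by (intro cSUP_least) auto

instance
proof
  fix X X' :: circle_field and a :: real
  show "(norm X = 0) = (X = 0)"
  proof
    assume "norm X = 0"
    then have "circle_field_at X z = 0" for z
      using norm_circle_field_at_le[of X z] by simp
    then show "X = 0"
      by (intro circle_field_eqI) (simp add: zero_circle_field.rep_eq)
  next
    assume "X = 0"
    then show "norm X = 0"
      by (simp add: norm_circle_field_def zero_circle_field.rep_eq)
  qed
  show "norm (X + X') \<le> norm X + norm X'"
    by (rule norm_circle_field_leI)
      (auto simp: plus_circle_field.rep_eq
        intro!: norm_triangle_le add_mono norm_circle_field_at_le)
  have le: "norm (b *\<^sub>R Y) \<le> \<bar>b\<bar> * norm Y" for b :: real and Y :: circle_field
    by (rule norm_circle_field_leI)
      (auto simp: scaleR_circle_field.rep_eq intro!: mult_left_mono norm_circle_field_at_le)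
  show "norm (a *\<^sub>R X) = \<bar>a\<bar> * norm X"
  proof (rule antisym[OF le])
    show "\<bar>a\<bar> * norm X \<le> norm (a *\<^sub>R X)"
    proof (cases "a = 0")
      case True
      have "0 \<le> norm (circle_field_at (0 *\<^sub>R X) 1)" by simp
      also have "\<dots> \<le> norm (0 *\<^sub>R X)" by (rule norm_circle_field_at_le)
      finally show ?thesis using True by simp
    next
      case False
      then show ?thesis
        using le[of "inverse a" "a *\<^sub>R X"] by (simp add: field_simps)
    qed
  qed
qed (rule dist_circle_field_def sgn_circle_field_def uniformity_circle_field_def
      open_circle_field_def)+

end

instance circle_field :: banach
proof
  fix X :: "nat \<Rightarrow> circle_field"
  assume "Cauchy X"
  have dist_le: "dist (circle_field_at Y z) (circle_field_at Y' z) \<le> dist Y Y'" for Y Y' z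
    using norm_circle_field_at_le[of "Y - Y'" z]
    by (simp add: dist_norm minus_circle_field.rep_eq)
  obtain l where l: "uniform_limit UNIV (\<lambda>n. circle_field_at (X n)) l sequentially"
    using \<open>Cauchy X\<close> uniformly_convergent_eq_cauchy[of "\<lambda>_. True" "\<lambda>n. circle_field_at (X n)"]
    unfolding Cauchy_def uniform_limit_sequentially_iff
    by (metis dist_le order_le_less_trans)
  have lim: "(\<lambda>n. circle_field_at (X n) z) \<longlonglongrightarrow> l z" for z
    using tendsto_uniform_limitI[OF l] by auto
  have "continuous_on (sphere 0 1) l"
  proof (rule uniform_limit_theorem[OF _ uniform_limit_on_subset[OF l]])
    show "\<forall>\<^sub>F n in sequentially. continuous_on (sphere 0 1) (circle_field_at (X n))"
      using circle_field_at by auto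
  qed auto
  moreover have "l z \<bullet> z = 0" if "z \<in> sphere 0 1" for z
  proof -
    have "circle_field_at (X n) z \<bullet> z = 0" for n
      using circle_field_at[of "X n"] that by auto
    then show ?thesis
      using tendsto_inner[OF lim[of z] tendsto_const[of z]] by (simp add: LIMSEQ_const_iff)
  qed
  moreover have "l z = 0" if "z \<notin> sphere 0 1" for z
  proof -
    have "circle_field_at (X n) z = 0" for n
      using circle_field_at[of "X n"] that by auto
    then show ?thesis
      using lim[of z] by (simp add: LIMSEQ_const_iff)
  qed
  ultimately have L: "circle_field_at (Circle_field l) = l"
    by (intro Circle_field_inverse) auto
  have "X \<longlonglongrightarrow> Circle_field l"
  proof (rule tendstoI)
    fix e :: real
    assume "0 < e"
    then have "\<forall>\<^sub>F n in sequentially. \<forall>z. dist (circle_field_at (X n) z) (l z) < e / 2"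
      using uniform_limitD[OF l, of "e / 2"] by simp
    then show "\<forall>\<^sub>F n in sequentially. dist (X n) (Circle_field l) < e"
    proof eventually_elim
      case (elim n)
      have "norm (X n - Circle_field l) \<le> e / 2"
        using elim by (intro norm_circle_field_leI)
          (auto simp: minus_circle_field.rep_eq L dist_norm intro: less_imp_le)
      then show ?case
        using \<open>0 < e\<close> by (simp add: dist_norm)
    qed
  qed
  then show "convergent X"
    by (rule convergentI)
qed


section \<open>Convolution with the Poisson kernel vector field\<close>

definition rotation_field :: "complex \<Rightarrow> complex"
  where "rotation_field z = \<i> * z"

text \<open>
  A circle field is \<open>f Y\<close> for a continuous real \<open>f\<close> that is unique on the circle, so requiring
  \<open>F (f Y) = f * K\<close> for all \<open>f\<close> specifies \<open>F\<close> on all circle fields.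
\<close>

lemma circle_field_coefficient:
  shows "\<exists>f :: complex \<Rightarrow> real. continuous_on (sphere 0 1) f \<and>
      (\<forall>w\<in>sphere 0 1. circle_field_at X w = of_real (f w) * rotation_field w)"
    and "\<lbrakk>\<forall>w\<in>sphere 0 1. circle_field_at X w = of_real (f w) * rotation_field w;
      \<forall>w\<in>sphere 0 1. circle_field_at X w = of_real (g w) * rotation_field w\<rbrakk>
      \<Longrightarrow> \<forall>w\<in>sphere 0 1. f w = g w"
proof -
  let ?f = "\<lambda>w. circle_field_at X w \<bullet> rotation_field w"
  have "continuous_on (sphere 0 1) (circle_field_at X)"
    using circle_field_at by auto
  then have "continuous_on (sphere 0 1) ?f"
    unfolding rotation_field_def by (intro continuous_intros)
  moreover have "circle_field_at X w = of_real (?f w) * rotation_field w"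
    if w: "w \<in> sphere 0 1" for w
  proof -
    obtain a b where X: "circle_field_at X w = Complex a b"
      by (cases "circle_field_at X w")
    obtain c d where W: "w = Complex c d"
      by (cases w)
    have "c\<^sup>2 + d\<^sup>2 = 1"
      using w unfolding W by (simp add: complex_norm)
    moreover have "a * c + b * d = 0"
    proof -
      have "circle_field_at X w \<bullet> w = 0"
        using circle_field_at[of X] w by auto
      then show ?thesis
        unfolding X unfolding W by (simp add: inner_complex_def)
    qed
    ultimately have "a = (b * c - a * d) * - d" "b = (b * c - a * d) * c"
      by algebra+
    then show ?thesis
      unfolding X by (simp add: W rotation_field_def inner_complex_def complex_eq_iff)
  qed
  ultimately show "\<exists>f :: complex \<Rightarrow> real. continuous_on (sphere 0 1) f \<and>
      (\<forall>w\<in>sphere 0 1. circle_field_at X w = of_real (f w) * rotation_field w)"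
    by (intro exI[of _ ?f]) auto
  show "\<forall>w\<in>sphere 0 1. f w = g w"
    if "\<forall>w\<in>sphere 0 1. circle_field_at X w = of_real (f w) * rotation_field w"
      "\<forall>w\<in>sphere 0 1. circle_field_at X w = of_real (g w) * rotation_field w"
    using that by (auto simp: rotation_field_def)
qed

text \<open>Integration with respect to arc length, via the unit-speed parametrization \<open>cis\<close>.\<close>

definition circle_integral :: "(complex \<Rightarrow> complex) \<Rightarrow> complex"
  where "circle_integral h = integral {0..2 * pi} (\<lambda>t. h (cis t))"

definition circle_convolution :: "(complex \<Rightarrow> real) \<Rightarrow> (complex \<Rightarrow> complex) \<Rightarrow> complex \<Rightarrow> complex"
  where "circle_convolution f K z =
    1 / (2 * of_real pi) * circle_integral (\<lambda>w. of_real (f w) * w * K (z * inverse w))"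

definition poisson_field :: "complex \<Rightarrow> complex"
  where "poisson_field z =
    \<i> * of_real ((1 - (cmod z)\<^sup>2) ^ 3) / (of_real ((cmod (1 - cnj z))\<^sup>2) * (1 - cnj z)\<^sup>2)"


section \<open>Smooth maps\<close>

definition dir_deriv :: "('a::real_normed_vector \<Rightarrow> 'b::real_normed_vector) \<Rightarrow> 'a \<Rightarrow> 'a \<Rightarrow> 'b"
  where "dir_deriv f x v = frechet_derivative f (at x) v"

text \<open>Intended for open \<open>S\<close>.\<close>

primrec Ck_on :: "nat \<Rightarrow> ('a::euclidean_space \<Rightarrow> 'b::real_normed_vector) \<Rightarrow> 'a set \<Rightarrow> bool"
  where
    "Ck_on 0 f S \<longleftrightarrow> continuous_on S f"
  | "Ck_on (Suc k) f S \<longleftrightarrow>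
      (\<forall>x\<in>S. f differentiable (at x)) \<and> (\<forall>v. Ck_on k (\<lambda>x. dir_deriv f x v) S)"

text \<open>
  On a set that need not be open, such as \<open>[0, \<epsilon>) \<times> U\<close>, smoothness means having smooth local
  extensions. For open sets the extensions may be taken to be \<open>f\<close> itself.
\<close>

definition smooth_on :: "'a::euclidean_space set \<Rightarrow> ('a \<Rightarrow> 'b::real_normed_vector) \<Rightarrow> bool"
  where "smooth_on S f \<longleftrightarrow>
    (\<forall>x\<in>S. \<exists>W g. open W \<and> x \<in> W \<and> (\<forall>k. Ck_on k g W) \<and> (\<forall>y\<in>S \<inter> W. g y = f y))"


section \<open>Tension field and harmonic vector fields on the hyperbolic disk\<close>

definition hyp_metric :: "complex \<Rightarrow> complex \<Rightarrow> complex \<Rightarrow> real"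
  where "hyp_metric p u v = 4 * (u \<bullet> v) / (1 - (norm p)\<^sup>2)\<^sup>2"

text \<open>
  The right-hand side of the Koszul formula for constant fields \<open>u\<close>, \<open>v\<close>, \<open>w\<close>, and the vector
  \<open>\<nabla>\<^sub>u v\<close> at \<open>p\<close> that it determines. The standard basis is orthogonal for the metric, which
  gives the explicit sum.
\<close>

definition koszul :: "complex \<Rightarrow> complex \<Rightarrow> complex \<Rightarrow> complex \<Rightarrow> real"
  where "koszul p u v w =
    (dir_deriv (\<lambda>q. hyp_metric q v w) p u + dir_deriv (\<lambda>q. hyp_metric q u w) p v
      - dir_deriv (\<lambda>q. hyp_metric q u v) p w) / 2"

definition christoffel :: "complex \<Rightarrow> complex \<Rightarrow> complex \<Rightarrow> complex"
  where "christoffel p u v = (\<Sum>e\<in>Basis. (koszul p u v e / hyp_metric p e e) *\<^sub>R e)"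

lemma hyp_metric_christoffel:
  assumes "p \<in> ball 0 1"
  shows "hyp_metric p (christoffel p u v) w = koszul p u v w"
proof -
  define c where "c q = 4 / (1 - (norm q)\<^sup>2)\<^sup>2" for q :: complex
  have np: "1 - p \<bullet> p \<noteq> 0"
    using assms norm_ge_zero[of p]
    by (simp add: dot_square_norm power2_eq_1_iff del: norm_ge_zero)
  have c: "c = (\<lambda>q. 4 / (1 - q \<bullet> q)\<^sup>2)"
    by (simp add: c_def fun_eq_iff dot_square_norm)
  have "c differentiable (at p)"
    unfolding c using np by (intro derivative_intros) auto
  then obtain c' where c': "(c has_derivative c') (at p)"
    by (auto simp: differentiable_def)
  have m: "hyp_metric q a b = c q * (a \<bullet> b)" for q a b
    by (simp add: hyp_metric_def c_def)
  have d: "dir_deriv (\<lambda>q. hyp_metric q a b) p x = c' x * (a \<bullet> b)" for a b x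
  proof -
    have "((\<lambda>q. hyp_metric q a b) has_derivative (\<lambda>x. c' x * (a \<bullet> b))) (at p)"
      unfolding m by (intro has_derivative_mult_left c')
    then show ?thesis
      unfolding dir_deriv_def by (simp add: frechet_derivative_at[symmetric])
  qed
  have "linear c'"
    using c' has_derivative_linear by blast
  then interpret linear c' .
  have "linear (koszul p u v)"
    unfolding koszul_def d
    by (intro linearI) (simp_all add: add scaleR inner_add_right algebra_simps
        add_divide_distrib diff_divide_distrib)
  then have "koszul p u v w = (\<Sum>e\<in>Basis. (w \<bullet> e) * koszul p u v e)"
    using linear_sum[of "koszul p u v" "\<lambda>e. (w \<bullet> e) *\<^sub>R e" Basis]
    by (simp add: euclidean_representation linear_cmul)
  moreover have "c p \<noteq> 0"
    using np by (simp add: c)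
  ultimately show ?thesis
    unfolding christoffel_def m
    by (simp add: inner_sum_left sum_distrib_left inner_commute[of w] mult.commute)
qed

text \<open>Covariant derivative along \<open>\<phi>\<close>, in the direction \<open>v\<close>, of a section \<open>s\<close> of \<open>\<phi>\<^sup>-\<^sup>1 T\<D>\<close>.\<close>

definition pullback_connection ::
  "(complex \<Rightarrow> complex) \<Rightarrow> (complex \<Rightarrow> complex) \<Rightarrow> complex \<Rightarrow> complex \<Rightarrow> complex"
  where "pullback_connection \<phi> s x v =
    dir_deriv s x v + christoffel (\<phi> x) (dir_deriv \<phi> x v) (s x)"

text \<open>
  \<open>(\<nabla>\<^sub>v d\<phi>)(w) = \<nabla>\<^sub>v (d\<phi>(w)) - d\<phi>(\<nabla>\<^sub>v w)\<close> with \<open>w\<close> extended to a constant field.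
\<close>

definition nabla_d ::
  "(complex \<Rightarrow> complex) \<Rightarrow> complex \<Rightarrow> complex \<Rightarrow> complex \<Rightarrow> complex"
  where "nabla_d \<phi> x v w =
    pullback_connection \<phi> (\<lambda>y. dir_deriv \<phi> y w) x v - dir_deriv \<phi> x (christoffel x v w)"

text \<open>The trace is with respect to the hyperbolic metric, for which \<open>Basis\<close> is orthogonal.\<close>

definition tension_field :: "(complex \<Rightarrow> complex) \<Rightarrow> complex \<Rightarrow> complex"
  where "tension_field \<phi> x = (\<Sum>e\<in>Basis. nabla_d \<phi> x e e /\<^sub>R hyp_metric x e e)"

text \<open>
  The derivatives in \<open>t\<close> at \<open>0\<close> are one-sided. The joint smoothness of \<open>(t, z) \<mapsto> \<phi> t z\<close>
  on \<open>[0, \<epsilon>) \<times> U\<close> includes that of each \<open>\<phi> t\<close>.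
\<close>

definition harmonic_field_on :: "complex set \<Rightarrow> (complex \<Rightarrow> complex) \<Rightarrow> bool"
  where "harmonic_field_on U \<xi> \<longleftrightarrow>
    open U \<and> U \<subseteq> ball 0 1 \<and> smooth_on U \<xi> \<and>
    (\<exists>\<epsilon>>0. \<exists>\<phi> :: real \<Rightarrow> complex \<Rightarrow> complex.
      smooth_on ({0..<\<epsilon>} \<times> U) (\<lambda>(t, z). \<phi> t z) \<and>
      (\<forall>t\<in>{0..<\<epsilon>}. \<phi> t ` U \<subseteq> ball 0 1) \<and>
      (\<forall>z\<in>U. \<phi> 0 z = z) \<and>
      (\<forall>z\<in>U. ((\<lambda>t. \<phi> t z) has_vector_derivative \<xi> z) (at 0 within {0..<\<epsilon>})) \<and>
      (\<forall>z\<in>U. ((\<lambda>t. tension_field (\<phi> t) z) has_vector_derivative 0) (at 0 within {0..<\<epsilon>})))"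

end

theory Submission
  imports Defs "HOL-Complex_Analysis.Complex_Analysis"
begin

text \<open>
  The linearization at the identity of the tension field annihilates \<open>\<xi>\<close> exactly when
  \<open>(1 - |z|\<^sup>2)\<^sup>-\<^sup>2 \<partial>\<xi>/\<partial>cnj z\<close> is antiholomorphic, which holds for every rotated copy of the kernel. Given
  such \<open>\<xi>\<close>, the maps \<open>z + t u\<^sup>2 \<xi> / (u\<^sup>2 + t\<^sup>2 q\<^sup>2)\<close> with \<open>u = 1 - |z|\<^sup>2\<close> and \<open>q = 1 + |\<xi>|\<^sup>2\<close> have
  velocity \<open>\<xi>\<close> at \<open>t = 0\<close>, and they stay in the disk for all \<open>t\<close> because the displacement is at most
  \<open>u / 4\<close>.
\<close>

section \<open>Calculus of \<open>Ck_on\<close>\<close>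

text \<open>In the complex coordinate the tension field of \<phi> is, up to a positive factor, the
  Laplacian of \<phi> plus \<open>2 * cnj \<phi> / (1 - |\<phi>|\<^sup>2)\<close> times the sum of
  the squares of the two partial derivatives. That sum vanishes at the identity, so the variation of
  its coefficient does not count, and the linearization is a multiple of \<open>u\<^sup>2\<close>
  times the z-derivative of \<open>u\<^sup>-\<^sup>2 \<partial>\<xi>/\<partial>cnj z\<close>. Hence
  the criterion. The obstacle is that harmonicity asks for maps of the whole disk into itself with
  one common \<epsilon>, whereas \<open>z + t \<xi>\<close> may leave the disk near the boundary for
  every \<open>t > 0\<close>: no bound on \<xi> is assumed there. The damping factor
  \<open>1 / (1 + t\<^sup>2 q\<^sup>2 / u\<^sup>2)\<close> contains only the square of t, so the
  velocity at 0 is unchanged; q is built from the square of the modulus of \<xi> in order to be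
  smooth. Smoothness of the convolution is reduced to complex analysis: the kernel splits into
  powers of z times holomorphic or antiholomorphic functions of z, and then one complex derivative
  under the integral is enough.\<close>

lemma dir_deriv_eq: "(f has_derivative f') (at x) \<Longrightarrow> dir_deriv f x v = f' v"
  unfolding dir_deriv_def by (simp add: frechet_derivative_at[symmetric])

lemma has_derivative_dir_deriv:
  "f differentiable (at x) \<Longrightarrow> (f has_derivative dir_deriv f x) (at x)"
  using dir_deriv_eq by (metis differentiable_def ext)

lemma has_derivative_dir_deriv_Ck:
  "Ck_on (Suc k) f S \<Longrightarrow> x \<in> S \<Longrightarrow> (f has_derivative dir_deriv f x) (at x)"
  by (simp add: has_derivative_dir_deriv)

text \<open>Derivatives at points of an open set depend only on values near them, so
  \<open>dir_deriv\<close>, although formed from total functions, ignores what happens off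
  \<open>S\<close>.\<close>

lemma Ck_on_cong:
  assumes "open S" "\<And>x. x \<in> S \<Longrightarrow> f x = g x" "Ck_on k f S"
  shows "Ck_on k g S"
  using assms
proof (induction k arbitrary: f g)
  case 0
  then show ?case
    using continuous_on_cong by fastforce
next
  case (Suc k)
  have d: "(g has_derivative dir_deriv f x) (at x)" if "x \<in> S" for x
    by (rule has_derivative_transform_within_open[OF _ Suc.prems(1) that Suc.prems(2)])
      (use Suc.prems(3) that in \<open>auto intro: has_derivative_dir_deriv\<close>)
  have "Ck_on k (\<lambda>x. dir_deriv g x v) S" for v
    by (rule Suc.IH[of "\<lambda>x. dir_deriv f x v"])
      (use Suc.prems dir_deriv_eq[OF d] in auto)
  with d show ?case
    by (auto simp: differentiable_def)
qed

text \<open>Bridge from the formulas that differentiation rules produce, valid on \<open>S\<close>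
  only, to the recursive clause in terms of \<open>dir_deriv\<close>. Most closure properties below
  are inductions through it.\<close>

lemma Ck_on_SucI:
  assumes "open S" "\<And>x. x \<in> S \<Longrightarrow> (f has_derivative f' x) (at x)"
    and "\<And>v. Ck_on k (\<lambda>x. f' x v) S"
  shows "Ck_on (Suc k) f S"
proof -
  have "Ck_on k (\<lambda>x. dir_deriv f x v) S" for v
    by (rule Ck_on_cong[OF assms(1) _ assms(3)]) (simp add: dir_deriv_eq[OF assms(2)])
  with assms(2) show ?thesis
    by (auto simp: differentiable_def)
qed

lemma Ck_on_SucD: "Ck_on (Suc k) f S \<Longrightarrow> Ck_on k f S"
proof (induction k arbitrary: f)
  case 0
  then show ?case
    by (auto intro!: continuous_at_imp_continuous_on differentiable_imp_continuous_within)
next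
  case (Suc k)
  from Suc.prems have "Ck_on (Suc k) (\<lambda>x. dir_deriv f x v) S" for v
    unfolding Ck_on.simps(2)[of "Suc k"] by blast
  with Suc show ?case
    by auto
qed

lemma Ck_on_const: "Ck_on k (\<lambda>_. c) S"
proof (induction k arbitrary: c)
  case (Suc k)
  have "dir_deriv (\<lambda>_. c) x v = 0" for x :: 'a and v
    by (simp add: dir_deriv_eq[OF has_derivative_const])
  then show ?case
    using Suc by simp
qed simp

lemma Ck_on_bounded_linear:
  assumes "bounded_linear f" "open S"
  shows "Ck_on k f S"
proof (cases k)
  case 0
  then show ?thesis
    using assms by (simp add: linear_continuous_on)
next
  case (Suc k')
  show ?thesis
    unfolding Suc by (rule Ck_on_SucI[OF assms(2) bounded_linear_imp_has_derivative[OF assms(1)]])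
      (rule Ck_on_const)
qed

lemma Ck_on_bounded_linear_compose:
  assumes "bounded_linear L" "open S" "Ck_on k f S"
  shows "Ck_on k (\<lambda>x. L (f x)) S"
  using assms(3)
proof (induction k arbitrary: f)
  case 0
  then show ?case
    using assms(1) by (auto intro: bounded_linear.continuous_on)
next
  case (Suc k)
  show ?case
    by (rule Ck_on_SucI[OF assms(2) bounded_linear.has_derivative[OF assms(1)
          has_derivative_dir_deriv_Ck[OF Suc.prems]]])
      (use Suc in auto)
qed

text \<open>Serves to lift functions of z to functions of (t, z) along the projection. For linear
  \<open>L\<close> the derivative in direction \<open>v\<close> is again a function composed with
  \<open>L\<close>, so the induction closes.\<close>

lemma Ck_on_compose_bounded_linear:
  assumes "bounded_linear L" "open S" "Ck_on k f S"
  shows "Ck_on k (\<lambda>x. f (L x)) (L -` S)"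
  using assms(3)
proof (induction k arbitrary: f)
  case 0
  then show ?case
    using linear_continuous_on[OF assms(1)]
    by (auto intro: continuous_on_compose2)
next
  case (Suc k)
  have o: "open (L -` S)"
    using assms by (intro open_vimage linear_continuous_on)
  have d: "((\<lambda>x. f (L x)) has_derivative (\<lambda>v. dir_deriv f (L x) (L v))) (at x)"
    if "x \<in> L -` S" for x
    using has_derivative_compose[OF bounded_linear_imp_has_derivative[OF assms(1)]
        has_derivative_dir_deriv_Ck[OF Suc.prems]] that by auto
  show ?case
    by (rule Ck_on_SucI[OF o d]) (use Suc in auto)
qed

lemma Ck_on_add:
  assumes "open S" "Ck_on k f S" "Ck_on k g S"
  shows "Ck_on k (\<lambda>x. f x + g x) S"
  using assms(2,3)
proof (induction k arbitrary: f g)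
  case 0
  then show ?case
    by (auto intro: continuous_intros)
next
  case (Suc k)
  show ?case
    by (rule Ck_on_SucI[OF assms(1) has_derivative_add[OF
          has_derivative_dir_deriv_Ck[OF Suc.prems(1)] has_derivative_dir_deriv_Ck[OF Suc.prems(2)]]])
      (use Suc in auto)
qed

lemma Ck_on_mult:
  fixes f g :: "'a::euclidean_space \<Rightarrow> 'b::real_normed_algebra"
  assumes "open S" "Ck_on k f S" "Ck_on k g S"
  shows "Ck_on k (\<lambda>x. f x * g x) S"
  using assms(2,3)
proof (induction k arbitrary: f g)
  case 0
  then show ?case
    by (auto intro: continuous_intros)
next
  case (Suc k)
  show ?case
  proof (rule Ck_on_SucI[OF assms(1) has_derivative_mult[OF
          has_derivative_dir_deriv_Ck[OF Suc.prems(1)] has_derivative_dir_deriv_Ck[OF Suc.prems(2)]]])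
    fix v
    show "Ck_on k (\<lambda>x. f x * dir_deriv g x v + dir_deriv f x v * g x) S"
      using Suc.prems Suc.prems[THEN Ck_on_SucD] by (intro Ck_on_add[OF assms(1)] Suc.IH) auto
  qed auto
qed

lemma Ck_on_power:
  fixes f :: "'a::euclidean_space \<Rightarrow> 'b::real_normed_algebra_1"
  assumes "open S" "Ck_on k f S"
  shows "Ck_on k (\<lambda>x. f x ^ n) S"
  by (induction n) (auto intro: Ck_on_const Ck_on_mult assms)

lemma Ck_on_diff:
  fixes f g :: "'a::euclidean_space \<Rightarrow> 'b::real_normed_vector"
  assumes "open S" "Ck_on k f S" "Ck_on k g S"
  shows "Ck_on k (\<lambda>x. f x - g x) S"
  using Ck_on_add[OF assms(1,2) Ck_on_bounded_linear_compose[OF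
        bounded_linear_minus[OF bounded_linear_ident] assms(1,3)]]
  by simp

text \<open>The derivative of \<open>1 / f\<close> is a polynomial in \<open>1 / f\<close> and the
  derivative of \<open>f\<close>, so the induction runs with \<open>f\<close> fixed.\<close>

lemma Ck_on_inverse:
  fixes f :: "'a::euclidean_space \<Rightarrow> 'b::real_normed_field"
  assumes "open S" "\<And>x. x \<in> S \<Longrightarrow> f x \<noteq> 0" "Ck_on k f S"
  shows "Ck_on k (\<lambda>x. inverse (f x)) S"
  using assms(3)
proof (induction k)
  case 0
  then show ?case
    using assms(2) by (auto intro: continuous_intros)
next
  case (Suc k)
  show ?case
  proof (rule Ck_on_SucI[OF assms(1) Deriv.has_derivative_inverse[OF assms(2)
          has_derivative_dir_deriv_Ck[OF Suc.prems]]])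
    fix v
    have "Ck_on k (\<lambda>x. 0 - inverse (f x) * dir_deriv f x v * inverse (f x)) S"
      using Suc.prems Suc.IH[OF Ck_on_SucD[OF Suc.prems]]
      by (intro Ck_on_diff Ck_on_mult Ck_on_const assms(1)) auto
    then show "Ck_on k (\<lambda>x. - (inverse (f x) * dir_deriv f x v * inverse (f x))) S"
      by simp
  qed auto
qed

text \<open>A real directional derivative of a holomorphic function is its complex derivative times
  the direction, hence holomorphic again.\<close>

lemma Ck_on_holomorphic:
  assumes "open S" "f holomorphic_on S"
  shows "Ck_on k f S"
  using assms(2)
proof (induction k arbitrary: f)
  case 0
  then show ?case
    by (simp add: holomorphic_on_imp_continuous_on)
next
  case (Suc k)
  have "(f has_derivative (\<lambda>v. deriv f x * v)) (at x)" if "x \<in> S" for x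
    using holomorphic_derivI[OF Suc.prems assms(1) that, of UNIV]
    by (simp add: has_field_derivative_def)
  then show ?case
    by (rule Ck_on_SucI[OF assms(1)])
      (auto intro!: Suc.IH holomorphic_intros holomorphic_deriv Suc.prems assms)
qed

lemma smooth_on_open:
  assumes "open S" "\<And>k. Ck_on k f S"
  shows "smooth_on S f"
  unfolding smooth_on_def using assms by blast

section \<open>Tension field\<close>

lemma one_minus_norm_pos: "p \<in> ball (0::complex) 1 \<Longrightarrow> 0 < 1 - (cmod p)\<^sup>2"
  by (simp add: power_less_one_iff)

lemma of_real_one_minus_norm: "of_real (1 - (cmod z)\<^sup>2) = 1 - z * cnj z"
  by (simp only: of_real_diff of_real_1 complex_norm_square)

text \<open>For a conformal metric with factor \<open>exp (2 * s)\<close> the connection gives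
  \<open>2 ds(u) u - |u|\<^sup>2 grad s\<close>. Here this is \<open>2 / (1 - |p|\<^sup>2)\<close>
  times \<open>2 (p \<bullet> u) u - |u|\<^sup>2 p\<close>, which collapses to
  \<open>cnj p * u\<^sup>2\<close> because
  \<open>2 (p \<bullet> u) = cnj p * u + p * cnj u\<close>.\<close>

lemma christoffel_diag:
  assumes p: "p \<in> ball 0 1"
  shows "christoffel p u u = 2 * cnj p * u\<^sup>2 / of_real (1 - (cmod p)\<^sup>2)"
proof -
  define c where "c = 1 - (cmod p)\<^sup>2"
  have c: "c > 0" "1 - p \<bullet> p = c"
    using one_minus_norm_pos[OF p] by (auto simp: c_def dot_square_norm)
  have d: "dir_deriv (\<lambda>q. hyp_metric q a b) p v = 16 * (p \<bullet> v) * (a \<bullet> b) / c ^ 3" for a b v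
  proof -
    have "((\<lambda>r. 4 * (a \<bullet> b) / r\<^sup>2) has_real_derivative - 8 * (a \<bullet> b) / c ^ 3) (at (1 - p \<bullet> p))"
      unfolding c(2) using c(1) by (auto intro!: derivative_eq_intros
          simp: power2_eq_square power3_eq_cube field_simps)
    moreover have "((\<lambda>q. 1 - q \<bullet> q) has_derivative (\<lambda>v. - 2 * (p \<bullet> v))) (at p)"
      by (auto intro!: derivative_eq_intros simp: inner_commute)
    ultimately show ?thesis
      unfolding hyp_metric_def dot_square_norm[symmetric]
      by (subst dir_deriv_eq[OF DERIV_compose_FDERIV]) auto
  qed
  have h: "hyp_metric p e e = 4 / c\<^sup>2" if "e \<in> Basis" for e
    using that by (simp add: hyp_metric_def c_def inner_Basis)
  have k: "koszul p u u e / hyp_metric p e e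
      = 2 * (2 * (p \<bullet> u) * (u \<bullet> e) - (p \<bullet> e) * (u \<bullet> u)) / c" if "e \<in> Basis" for e
    using c(1) unfolding koszul_def d h[OF that]
    by (simp add: field_simps power2_eq_square power3_eq_cube)
  have "christoffel p u u
      = (\<Sum>e\<in>Basis. (2 * (2 * (p \<bullet> u) * (u \<bullet> e) - (p \<bullet> e) * (u \<bullet> u)) / c) *\<^sub>R e)"
    unfolding christoffel_def by (intro sum.cong) (simp_all add: k)
  also have "\<dots> = 2 * cnj p * u\<^sup>2 / of_real c"
    using c(1) by (auto simp: Basis_complex_def complex_eq_iff inner_complex_def power2_eq_square
        field_simps)
  finally show ?thesis
    by (simp add: c_def)
qed

text \<open>The Christoffel terms of the domain cancel in the trace, as \<open>1\<^sup>2 + \<i>\<^sup>2 = 0\<close>.\<close>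

lemma tension_field_eq:
  assumes x: "x \<in> ball 0 1" "\<phi> x \<in> ball 0 1" and d: "\<phi> differentiable (at x)"
  shows "tension_field \<phi> x = of_real ((1 - (cmod x)\<^sup>2)\<^sup>2 / 4) *
    (dir_deriv (\<lambda>y. dir_deriv \<phi> y 1) x 1 + dir_deriv (\<lambda>y. dir_deriv \<phi> y \<i>) x \<i>
      + 2 * cnj (\<phi> x) / of_real (1 - (cmod (\<phi> x))\<^sup>2)
        * ((dir_deriv \<phi> x 1)\<^sup>2 + (dir_deriv \<phi> x \<i>)\<^sup>2))"
proof -
  have "linear (dir_deriv \<phi> x)"
    using has_derivative_dir_deriv[OF d] has_derivative_linear by blast
  then have "dir_deriv \<phi> x (christoffel x 1 1) + dir_deriv \<phi> x (christoffel x \<i> \<i>)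
      = dir_deriv \<phi> x (christoffel x 1 1 + christoffel x \<i> \<i>)"
    by (simp add: linear_add)
  also have "\<dots> = 0"
    using \<open>linear (dir_deriv \<phi> x)\<close> x(1) by (simp add: christoffel_diag linear_0)
  finally have z: "dir_deriv \<phi> x (christoffel x \<i> \<i>) = - dir_deriv \<phi> x (christoffel x 1 1)"
    by (simp add: add_eq_0_iff)
  show ?thesis
    unfolding tension_field_def nabla_d_def pullback_connection_def christoffel_diag[OF x(2)]
    by (simp add: Basis_complex_def hyp_metric_def z scaleR_conv_of_real add_divide_distrib
        algebra_simps inner_complex_def)
qed

section \<open>Variations of the identity and their tension fields\<close>

lemma has_vector_derivative_scaleR_at_0:
  fixes G :: "real \<Rightarrow> 'a::real_normed_vector"
  assumes "isCont G 0"
  shows "((\<lambda>t. t *\<^sub>R G t) has_vector_derivative G 0) (at 0)"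
proof -
  have "((\<lambda>t. norm (G t - G 0)) \<longlongrightarrow> 0) (at 0)"
    using assms unfolding isCont_def by (intro tendsto_norm_zero LIM_zero)
  \<comment> \<open>For nonzero \<open>t\<close> the difference quotient is exactly
    \<open>G t\<close>, so continuity of \<open>G\<close> at 0 is all that is required.\<close>
  moreover have "norm ((1 / norm (t - 0)) *\<^sub>R (t *\<^sub>R G t - (0 *\<^sub>R G 0 + (t - 0) *\<^sub>R G 0)))
      \<le> norm (G t - G 0)" for t :: real
    by (simp add: scaleR_diff_right[symmetric])
  ultimately show ?thesis
    unfolding has_vector_derivative_def has_derivative_within
    by (auto intro: bounded_linear_scaleR_left
        Lim_null_comparison[OF always_eventually, where g = "\<lambda>t. norm (G t - G 0)"])
qed

text \<open>
  A variation \<open>z + t \<eta>(t, z)\<close> has a tension field of the form \<open>t G(t)\<close> with \<open>G\<close> continuous, so its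
  derivative at \<open>0\<close> is \<open>G 0\<close>, the Jacobi operator applied to \<open>\<eta>(0, \<cdot>)\<close>.
\<close>

lemma tension_field_variation:
  fixes \<eta> :: "real \<times> complex \<Rightarrow> complex"
  assumes \<eta>: "Ck_on 2 \<eta> (UNIV \<times> ball 0 1)"
    and ball: "\<And>t. x + of_real t * \<eta> (t, x) \<in> ball 0 1"
    and x: "x \<in> ball 0 1"
    and \<xi>: "\<And>z. z \<in> ball 0 1 \<Longrightarrow> \<xi> z = \<eta> (0, z)"
    and jacobi: "dir_deriv (\<lambda>y. dir_deriv \<xi> y 1) x 1 + dir_deriv (\<lambda>y. dir_deriv \<xi> y \<i>) x \<i>
      + 4 * cnj x / of_real (1 - (cmod x)\<^sup>2) * (dir_deriv \<xi> x 1 + \<i> * dir_deriv \<xi> x \<i>) = 0"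
  shows "((\<lambda>t. tension_field (\<lambda>z. z + of_real t * \<eta> (t, z)) x) has_vector_derivative 0) (at 0)"
proof -
  define D where "D e p = dir_deriv \<eta> p (0, e)" for e p
  define DD where "DD e p = dir_deriv (D e) p (0, e)" for e p
  define \<phi> where "\<phi> = (\<lambda>t z. z + of_real t * \<eta> (t, z))"
  have C1: "Ck_on (Suc 0) (D e) (UNIV \<times> ball 0 1)" for e
    using \<eta> unfolding D_def numeral_2_eq_2 Ck_on.simps(2)[of "Suc 0"] by blast
  have d\<eta>: "(\<eta> has_derivative dir_deriv \<eta> p) (at p)" if "p \<in> UNIV \<times> ball 0 1" for p
    using \<eta> that unfolding numeral_2_eq_2 by (rule has_derivative_dir_deriv_Ck)
  have dD: "(D e has_derivative dir_deriv (D e) p) (at p)" if "p \<in> UNIV \<times> ball 0 1" for p e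
    using C1 that by (rule has_derivative_dir_deriv_Ck)
  have slice: "((\<lambda>y. h (t, y)) has_derivative (\<lambda>v. dir_deriv h (t, z) (0, v))) (at z)"
    if "(h has_derivative dir_deriv h (t, z)) (at (t, z))" for h :: "real \<times> complex \<Rightarrow> complex" and t z
    using has_derivative_compose[OF has_derivative_Pair[OF has_derivative_const has_derivative_ident]]
      that .
  have \<phi>': "(\<phi> t has_derivative (\<lambda>v. v + of_real t * D v (t, z))) (at z)"
    if "z \<in> ball 0 1" for t z
    unfolding \<phi>_def D_def using that
    by (auto intro!: derivative_eq_intros slice d\<eta>)
  have D\<phi>: "dir_deriv (\<phi> t) z e = e + of_real t * D e (t, z)" if "z \<in> ball 0 1" for t z e
    using dir_deriv_eq[OF \<phi>'[OF that]] .
  have DD\<phi>: "dir_deriv (\<lambda>y. dir_deriv (\<phi> t) y e) x e = of_real t * DD e (t, x)" for t e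
  proof -
    have "((\<lambda>y. e + of_real t * D e (t, y)) has_derivative
        (\<lambda>v. of_real t * dir_deriv (D e) (t, x) (0, v))) (at x)"
      using x by (auto intro!: derivative_eq_intros slice dD)
    then have "((\<lambda>y. dir_deriv (\<phi> t) y e) has_derivative
        (\<lambda>v. of_real t * dir_deriv (D e) (t, x) (0, v))) (at x)"
      by (rule has_derivative_transform_within_open[OF _ open_ball x]) (simp add: D\<phi>)
    from dir_deriv_eq[OF this] show ?thesis
      by (simp add: DD_def)
  qed
  have D\<xi>: "dir_deriv \<xi> z e = D e (0, z)" if "z \<in> ball 0 1" for z e
  proof (rule dir_deriv_eq[where f' = "\<lambda>v. D v (0, z)"])
    show "(\<xi> has_derivative (\<lambda>v. D v (0, z))) (at z)"
      unfolding D_def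
      by (rule has_derivative_transform_within_open[OF slice[OF d\<eta>] open_ball that])
        (use that \<xi> in auto)
  qed
  have DD\<xi>: "dir_deriv (\<lambda>y. dir_deriv \<xi> y e) x e = DD e (0, x)" for e
  proof -
    have "((\<lambda>y. dir_deriv \<xi> y e) has_derivative (\<lambda>v. dir_deriv (D e) (0, x) (0, v))) (at x)"
      by (rule has_derivative_transform_within_open[OF slice[OF dD] open_ball x])
        (use x D\<xi> in auto)
    from dir_deriv_eq[OF this] show ?thesis
      by (simp add: DD_def)
  qed
  \<comment> \<open>The tension field with a factor \<open>t\<close> taken out. Only continuity in
    \<open>t\<close> remains to be checked: no t-derivative of a spatial derivative appears, and two
    derivatives of \<eta> suffice.\<close>
  define G where "G t = of_real ((1 - (cmod x)\<^sup>2)\<^sup>2 / 4) *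
    (DD 1 (t, x) + DD \<i> (t, x) + 2 * cnj (\<phi> t x) / of_real (1 - (cmod (\<phi> t x))\<^sup>2)
      * (2 * (D 1 (t, x) + \<i> * D \<i> (t, x)) + of_real t * ((D 1 (t, x))\<^sup>2 + (D \<i> (t, x))\<^sup>2)))" for t
  have "tension_field (\<phi> t) x = t *\<^sub>R G t" for t
  proof -
    have "\<phi> t differentiable (at x)"
      using \<phi>'[OF x] by (auto simp: differentiable_def)
    moreover have "\<phi> t x \<in> ball 0 1"
      using ball by (simp add: \<phi>_def)
    \<comment> \<open>The constant term is \<open>1 + \<i>\<^sup>2 = 0\<close>, so the quadratic
      part yields a factor \<open>t\<close> too.\<close>
    moreover have "(1 + of_real t * D 1 (t, x))\<^sup>2 + (\<i> + of_real t * D \<i> (t, x))\<^sup>2 = of_real t *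
        (2 * (D 1 (t, x) + \<i> * D \<i> (t, x)) + of_real t * ((D 1 (t, x))\<^sup>2 + (D \<i> (t, x))\<^sup>2))"
      by (simp add: power2_eq_square algebra_simps)
    moreover have "c * (s * a + s * b + e * (s * d)) = s * (c * (a + b + e * d))"
      for a b c d e s :: complex
      by (simp add: algebra_simps)
    ultimately show ?thesis
      unfolding G_def scaleR_conv_of_real by (simp only: tension_field_eq[OF x] DD\<phi> D\<phi>[OF x])
  qed
  moreover have "isCont G 0"
  proof -
    have c: "continuous_on UNIV (\<lambda>t. h (t, x))" if "continuous_on (UNIV \<times> ball 0 1) h"
      for h :: "real \<times> complex \<Rightarrow> complex"
      using x by (intro continuous_on_compose2[OF that]) (auto intro!: continuous_intros)
    have "Ck_on 0 \<eta> (UNIV \<times> ball 0 1)"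
      using \<eta> unfolding numeral_2_eq_2 by (rule Ck_on_SucD[OF Ck_on_SucD])
    moreover have "continuous_on (UNIV \<times> ball 0 1) (D e)" for e
      using Ck_on_SucD[OF C1] by simp
    moreover have "continuous_on (UNIV \<times> ball 0 1) (DD e)" for e
      using C1 unfolding DD_def by simp
    moreover have "1 - (cmod (x + of_real t * \<eta> (t, x)))\<^sup>2 \<noteq> 0" for t
      using one_minus_norm_pos[OF ball[of t]] by simp
    then have "of_real (1 - (cmod (x + of_real t * \<eta> (t, x)))\<^sup>2) \<noteq> (0::complex)" for t
      by (simp only: of_real_eq_0_iff not_False_eq_True)
    ultimately have "continuous_on UNIV G"
      unfolding G_def \<phi>_def by (intro continuous_intros c) auto
    then show ?thesis
      by (simp add: continuous_on_eq_continuous_at)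
  qed
  moreover have "G 0 = 0"
  proof -
    have "2 * cnj x / b * (2 * w) = 4 * cnj x / b * w" for b w :: complex
      by simp
    then show ?thesis
      using jacobi unfolding G_def DD\<xi> D\<xi>[OF x] \<phi>_def of_real_0 mult_zero_left add_0_right
      by (simp only: mult_zero_right)
  qed
  ultimately show ?thesis
    using has_vector_derivative_scaleR_at_0[of G] by (simp add: \<phi>_def)
qed


section \<open>From the Jacobi equation to harmonic fields\<close>

lemma harmonic_field_onI:
  assumes \<xi>: "\<And>k. Ck_on k \<xi> (ball 0 1)"
    and jacobi: "\<And>x. x \<in> ball 0 1 \<Longrightarrow>
      dir_deriv (\<lambda>y. dir_deriv \<xi> y 1) x 1 + dir_deriv (\<lambda>y. dir_deriv \<xi> y \<i>) x \<i>
      + 4 * cnj x / of_real (1 - (cmod x)\<^sup>2) * (dir_deriv \<xi> x 1 + \<i> * dir_deriv \<xi> x \<i>) = 0"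
  shows "harmonic_field_on (ball 0 1) \<xi>"
proof -
  \<comment> \<open>With \<open>z * cnj z\<close> in place of the modulus, all ingredients are built
    by ring operations and inverses from \<open>z\<close>, \<open>t\<close>, \<open>\<xi>\<close>
    and conjugates, so the closure rules for \<open>Ck_on\<close> apply. The forms with
    \<open>cmod\<close> below serve the estimates.\<close>
  define u where "u z = 1 - z * cnj z" for z :: complex
  define q where "q z = 1 + \<xi> z * cnj (\<xi> z)" for z
  define d where "d p = (u (snd p))\<^sup>2 + (of_real (fst p))\<^sup>2 * (q (snd p))\<^sup>2" for p
  define \<eta> where "\<eta> p = (u (snd p))\<^sup>2 * \<xi> (snd p) * inverse (d p)" for p
  define \<phi> where "\<phi> = (\<lambda>t z. z + of_real t * \<eta> (t, z))"
  let ?S = "UNIV \<times> ball 0 1 :: (real \<times> complex) set"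
  have u: "u z = of_real (1 - (cmod z)\<^sup>2)" for z
    unfolding u_def of_real_one_minus_norm ..
  have q: "q z = of_real (1 + (cmod (\<xi> z))\<^sup>2)" for z
    unfolding q_def of_real_add complex_norm_square by simp
  have d: "d (t, z) = of_real ((1 - (cmod z)\<^sup>2)\<^sup>2 + t\<^sup>2 * (1 + (cmod (\<xi> z))\<^sup>2)\<^sup>2)" for t z
    by (simp add: d_def u q)
  have d_pos: "(1 - (cmod z)\<^sup>2)\<^sup>2 + t\<^sup>2 * (1 + (cmod (\<xi> z))\<^sup>2)\<^sup>2 > 0" if "z \<in> ball 0 1" for t z
    using one_minus_norm_pos[OF that] by (intro add_pos_nonneg) auto
  have d_nz: "d p \<noteq> 0" if "p \<in> ?S" for p
    using d_pos[of "snd p" "fst p"] that d[of "fst p" "snd p"]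
    by (metis less_irrefl mem_Times_iff of_real_eq_0_iff prod.collapse)
  have \<eta>_0: "\<eta> (0, z) = \<xi> z" if "z \<in> ball 0 1" for z
    using d_nz[of "(0, z)"] that by (simp add: \<eta>_def d_def)
  have open_S: "open ?S"
    by (intro open_Times) auto
  have snd: "Ck_on k (\<lambda>p::real \<times> complex. f (snd p)) ?S" if "Ck_on k f (ball 0 1)"
    for k and f :: "complex \<Rightarrow> complex"
  proof -
    have "snd -` ball 0 1 = ?S"
      by auto
    then show ?thesis
      using Ck_on_compose_bounded_linear[OF bounded_linear_snd open_ball that] by metis
  qed
  have T: "Ck_on k (\<lambda>p. complex_of_real (fst p)) ?S" for k
    by (intro Ck_on_bounded_linear open_S
        bounded_linear_compose[OF bounded_linear_of_real bounded_linear_fst])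
  have u_Ck: "Ck_on k u (ball 0 1)" and q_Ck: "Ck_on k q (ball 0 1)" for k
    unfolding u_def q_def
    by (intro Ck_on_add Ck_on_diff Ck_on_mult Ck_on_const \<xi> open_ball
        Ck_on_bounded_linear bounded_linear_ident bounded_linear_cnj
        Ck_on_bounded_linear_compose[OF bounded_linear_cnj])+
  have \<eta>_Ck: "Ck_on k \<eta> ?S" for k
  proof -
    have "Ck_on k d ?S"
      unfolding d_def by (intro Ck_on_add Ck_on_mult Ck_on_power T snd u_Ck q_Ck open_S)
    then show ?thesis
      unfolding \<eta>_def
      by (intro Ck_on_mult Ck_on_power snd u_Ck \<xi> open_S Ck_on_inverse d_nz)
  qed
  have \<phi>_ball: "\<phi> t z \<in> ball 0 1" if z: "z \<in> ball 0 1" for t z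
  proof -
    define U Q x where "U = 1 - (cmod z)\<^sup>2" and "Q = 1 + (cmod (\<xi> z))\<^sup>2" and "x = cmod (\<xi> z)"
    have U: "U > 0"
      using one_minus_norm_pos[OF z] by (simp add: U_def)
    have D: "U\<^sup>2 + t\<^sup>2 * Q\<^sup>2 > 0"
      using d_pos[OF z] by (simp add: U_def Q_def)
    \<comment> \<open>Two estimates of AM-GM type, each contributing a factor 1/2:
      \<open>2 * x \<le> Q\<close> and \<open>2 * \<bar>t\<bar> * U * Q \<le> U\<^sup>2 + t\<^sup>2
      * Q\<^sup>2\<close>. Together they bound the displacement by \<open>U / 4\<close> uniformly in
      \<open>t\<close>.\<close>
    have "0 \<le> (1 - x)\<^sup>2"
      by simp
    then have x: "2 * x \<le> Q"
      by (simp add: Q_def x_def power2_eq_square algebra_simps)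
    have "0 \<le> (U - \<bar>t\<bar> * Q)\<^sup>2"
      by simp
    then have tQ: "2 * (\<bar>t\<bar> * U * Q) \<le> U\<^sup>2 + t\<^sup>2 * Q\<^sup>2"
      by (simp add: power2_diff power_mult_distrib algebra_simps)
    have "cmod (of_real t * \<eta> (t, z)) = \<bar>t\<bar> * U\<^sup>2 * x / (U\<^sup>2 + t\<^sup>2 * Q\<^sup>2)"
    proof -
      have "of_real t * \<eta> (t, z) = of_real (t * U\<^sup>2 / (U\<^sup>2 + t\<^sup>2 * Q\<^sup>2)) * \<xi> z"
        unfolding \<eta>_def d U_def Q_def snd_conv u by (simp add: field_simps)
      then show ?thesis
        using D by (simp only: norm_mult norm_of_real abs_divide abs_mult x_def) simp
    qed
    also have "\<dots> \<le> U / 4"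
    proof -
      have "\<bar>t\<bar> * U\<^sup>2 * (2 * x) \<le> \<bar>t\<bar> * U\<^sup>2 * Q"
        using x by (intro mult_left_mono) auto
      moreover have "U * (2 * (\<bar>t\<bar> * U * Q)) \<le> U * (U\<^sup>2 + t\<^sup>2 * Q\<^sup>2)"
        using tQ U by (intro mult_left_mono) auto
      ultimately show ?thesis
        using D by (simp add: field_simps power2_eq_square)
    qed
    also have "U / 4 < 1 - cmod z"
    proof -
      have "U = (1 - cmod z) * (1 + cmod z)"
        by (simp add: U_def power2_eq_square algebra_simps)
      also have "\<dots> < (1 - cmod z) * 4"
        using z by (intro mult_strict_left_mono) auto
      finally show ?thesis
        by simp
    qed
    finally have "cmod z + cmod (of_real t * \<eta> (t, z)) < 1"
      by simp
    then show ?thesis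
      using norm_triangle_ineq[of z "of_real t * \<eta> (t, z)"] by (simp add: \<phi>_def)
  qed
  \<comment> \<open>The formula is smooth for all real \<open>t\<close>, negative ones included, so
    it is its own smooth extension at the boundary points \<open>t = 0\<close>.\<close>
  have \<phi>_smooth: "smooth_on ({0..<1} \<times> ball 0 1) (\<lambda>(t, z). \<phi> t z)"
  proof -
    have "(\<lambda>(t, z). \<phi> t z) = (\<lambda>p. snd p + of_real (fst p) * \<eta> p)"
      by (auto simp: \<phi>_def)
    moreover have "Ck_on k (\<lambda>p. snd p + of_real (fst p) * \<eta> p) ?S" for k
      by (intro Ck_on_add Ck_on_mult T \<eta>_Ck open_S Ck_on_bounded_linear bounded_linear_snd)
    ultimately show ?thesis
      unfolding smooth_on_def using open_S by fastforce
  qed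
  have \<phi>_deriv: "((\<lambda>t. \<phi> t z) has_vector_derivative \<xi> z) (at 0)" if z: "z \<in> ball 0 1" for z
  proof -
    have "continuous_on UNIV (\<lambda>t. \<eta> (t, z))"
      by (rule continuous_on_compose2[OF \<eta>_Ck[of 0, simplified]])
        (use z in \<open>auto intro!: continuous_intros\<close>)
    then have "isCont (\<lambda>t. \<eta> (t, z)) 0"
      by (simp add: continuous_on_eq_continuous_at)
    from has_vector_derivative_add[OF has_vector_derivative_const
        has_vector_derivative_scaleR_at_0[OF this], of z]
    show ?thesis
      by (simp add: \<phi>_def \<eta>_0[OF z] scaleR_conv_of_real)
  qed
  have tension: "((\<lambda>t. tension_field (\<phi> t) z) has_vector_derivative 0) (at 0)" if z: "z \<in> ball 0 1" for z
    unfolding \<phi>_def using \<phi>_ball[OF z] jacobi[OF z]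
    by (intro tension_field_variation[OF \<eta>_Ck _ z \<eta>_0[symmetric]]) (simp_all add: \<phi>_def)
  have \<phi>_tension: "((\<lambda>t. tension_field (\<phi> t) z) has_vector_derivative 0) (at 0 within {0..<1})"
    if "z \<in> ball 0 1" for z
    using tension[OF that] by (rule has_vector_derivative_at_within)
  show ?thesis
    unfolding harmonic_field_on_def
  proof (intro conjI exI[of _ "1::real"] exI[of _ \<phi>] ballI)
    show "smooth_on (ball 0 1) \<xi>"
      by (intro smooth_on_open open_ball \<xi>)
    show "((\<lambda>t. \<phi> t z) has_vector_derivative \<xi> z) (at 0 within {0..<1})" if "z \<in> ball 0 1" for z
      using \<phi>_deriv[OF that] by (rule has_vector_derivative_at_within)
    show "\<phi> t ` ball 0 1 \<subseteq> ball 0 1" for t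
      using \<phi>_ball by blast
    show "\<phi> 0 z = z" for z
      by (simp add: \<phi>_def)
  qed (rule \<phi>_smooth \<phi>_tension open_ball subset_refl zero_less_one | assumption)+
qed

text \<open>
  The hypotheses on \<open>P\<^sub>0\<close>, \<open>P\<^sub>1\<close>, \<open>P\<^sub>2\<close> say that the derivative of the field with respect to \<open>cnj z\<close> is
  \<open>(1 - |z|\<^sup>2)\<^sup>2 cnj (Q z)\<close>.
\<close>

lemma harmonic_field_on_antiholomorphic:
  assumes H: "H holomorphic_on ball 0 1"
    and P0: "\<And>z. z \<in> ball 0 1 \<Longrightarrow> (P0 has_field_derivative Q z) (at z)"
    and P1: "\<And>z. z \<in> ball 0 1 \<Longrightarrow> (P1 has_field_derivative - 2 * z * Q z) (at z)"
    and P2: "\<And>z. z \<in> ball 0 1 \<Longrightarrow> (P2 has_field_derivative z\<^sup>2 * Q z) (at z)"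
    and \<xi>: "\<And>z. z \<in> ball 0 1 \<Longrightarrow> \<xi> z = H z + cnj (P0 z) + z * cnj (P1 z) + z\<^sup>2 * cnj (P2 z)"
  shows "\<And>k. Ck_on k \<xi> (ball 0 1)" and "harmonic_field_on (ball 0 1) \<xi>"
proof -
  have holo: "P0 holomorphic_on ball 0 1" "P1 holomorphic_on ball 0 1" "P2 holomorphic_on ball 0 1"
    using P0 P1 P2 by (meson has_field_derivative_at_within holomorphic_onI field_differentiable_def)+
  have "deriv P0 holomorphic_on ball 0 1"
    by (intro holomorphic_deriv holo open_ball)
  then have Q: "Q holomorphic_on ball 0 1"
    by (rule holomorphic_transform) (simp add: DERIV_imp_deriv[OF P0])
  show Ck: "Ck_on k \<xi> (ball 0 1)" for k
  proof (rule Ck_on_cong[OF open_ball \<xi>[symmetric]])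
    show "Ck_on k (\<lambda>z. H z + cnj (P0 z) + z * cnj (P1 z) + z\<^sup>2 * cnj (P2 z)) (ball 0 1)"
      by (intro Ck_on_add Ck_on_mult Ck_on_power Ck_on_holomorphic H open_ball
          Ck_on_bounded_linear[OF bounded_linear_ident]
          Ck_on_bounded_linear_compose[OF bounded_linear_cnj] holo)
  qed auto
  have fd: "(h has_derivative (\<lambda>v. h' * v)) (at z)" if "(h has_field_derivative h') (at z)"
    for h h' and z :: complex
    using that by (simp add: has_field_derivative_def)
  have cd: "((\<lambda>z. cnj (h z)) has_derivative (\<lambda>v. cnj (h' * v))) (at z)"
    if "(h has_field_derivative h') (at z)" for h h' and z :: complex
    by (rule bounded_linear.has_derivative[OF bounded_linear_cnj fd[OF that]])
  have cid: "(cnj has_derivative cnj) (at z)" for z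
    by (rule bounded_linear_imp_has_derivative[OF bounded_linear_cnj])
  \<comment> \<open>\<open>A\<close> and \<open>B\<close> are the derivatives of \<xi> with respect
    to \<open>z\<close> and \<open>cnj z\<close>. In \<open>B\<close> the contributions of
    \<open>P0\<close>, \<open>P1\<close>, \<open>P2\<close> have coefficients \<open>1\<close>,
    \<open>- 2 * z * cnj z\<close>, \<open>(z * cnj z)\<^sup>2\<close> and combine to a
    square.\<close>
  define A where "A z = deriv H z + cnj (P1 z) + 2 * z * cnj (P2 z)" for z
  define B where "B z = (1 - z * cnj z)\<^sup>2 * cnj (Q z)" for z
  have D: "dir_deriv \<xi> z v = A z * v + B z * cnj v" if z: "z \<in> ball 0 1" for z v
  proof (rule dir_deriv_eq[where f' = "\<lambda>v. A z * v + B z * cnj v"])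
    have "((\<lambda>z. H z + cnj (P0 z) + z * cnj (P1 z) + z\<^sup>2 * cnj (P2 z)) has_derivative
        (\<lambda>v. A z * v + B z * cnj v)) (at z)"
      unfolding A_def B_def
      by (rule derivative_eq_intros fd[OF holomorphic_derivI[OF H open_ball z, of UNIV]]
          cd[OF P0[OF z]] cd[OF P1[OF z]] cd[OF P2[OF z]] refl)+
        (simp add: fun_eq_iff algebra_simps power2_eq_square)
    then show "(\<xi> has_derivative (\<lambda>v. A z * v + B z * cnj v)) (at z)"
      by (rule has_derivative_transform_within_open[OF _ open_ball z]) (simp add: \<xi>)
  qed
  have DD: "dir_deriv (\<lambda>y. dir_deriv \<xi> y e) z e =
      (deriv (deriv H) z * e - 2 * cnj (z * Q z * e) + 2 * e * cnj (P2 z)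
        + 2 * z * cnj (z\<^sup>2 * Q z * e)) * e
      + (- 2 * (1 - z * cnj z) * (e * cnj z + z * cnj e) * cnj (Q z)
        + (1 - z * cnj z)\<^sup>2 * cnj (deriv Q z * e)) * cnj e"
    if z: "z \<in> ball 0 1" for z e
  proof -
    have "((\<lambda>z. A z * e + B z * cnj e) has_derivative
      (\<lambda>v. (deriv (deriv H) z * v - 2 * cnj (z * Q z * v) + 2 * v * cnj (P2 z)
        + 2 * z * cnj (z\<^sup>2 * Q z * v)) * e
      + (- 2 * (1 - z * cnj z) * (v * cnj z + z * cnj v) * cnj (Q z)
        + (1 - z * cnj z)\<^sup>2 * cnj (deriv Q z * v)) * cnj e)) (at z)"
      unfolding A_def B_def
      by (rule derivative_eq_intros cid
          fd[OF holomorphic_derivI[OF holomorphic_deriv[OF H open_ball] open_ball z, of UNIV]]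
          cd[OF holomorphic_derivI[OF Q open_ball z, of UNIV]]
          cd[OF P1[OF z]] cd[OF P2[OF z]] refl)+
        (simp add: fun_eq_iff algebra_simps power2_eq_square)
    then have "((\<lambda>y. dir_deriv \<xi> y e) has_derivative
      (\<lambda>v. (deriv (deriv H) z * v - 2 * cnj (z * Q z * v) + 2 * v * cnj (P2 z)
        + 2 * z * cnj (z\<^sup>2 * Q z * v)) * e
      + (- 2 * (1 - z * cnj z) * (v * cnj z + z * cnj v) * cnj (Q z)
        + (1 - z * cnj z)\<^sup>2 * cnj (deriv Q z * v)) * cnj e)) (at z)"
      by (rule has_derivative_transform_within_open[OF _ open_ball z]) (simp add: D)
    from dir_deriv_eq[OF this] show ?thesis .
  qed
  show "harmonic_field_on (ball 0 1) \<xi>"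
  proof (rule harmonic_field_onI[OF Ck])
    fix z :: complex
    assume z: "z \<in> ball 0 1"
    have "1 - z * cnj z \<noteq> 0"
      using one_minus_norm_pos[OF z] of_real_one_minus_norm[of z]
      by (metis less_irrefl of_real_eq_0_iff)
    \<comment> \<open>This combination is twice the derivative in \<open>cnj z\<close>; the part
      with \<open>A\<close> cancels.\<close>
    moreover have "dir_deriv \<xi> z 1 + \<i> * dir_deriv \<xi> z \<i> = 2 * (1 - z * cnj z)\<^sup>2 * cnj (Q z)"
      unfolding D[OF z] B_def by (simp add: algebra_simps)
    ultimately have "4 * cnj z / of_real (1 - (cmod z)\<^sup>2) * (dir_deriv \<xi> z 1 + \<i> * dir_deriv \<xi> z \<i>)
        = 8 * cnj z * (1 - z * cnj z) * cnj (Q z)"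
      unfolding of_real_one_minus_norm by (simp add: power2_eq_square)
    \<comment> \<open>The Laplacian is four times the z-derivative of \<open>B\<close>. Since
      \<open>cnj (Q z)\<close> is antiholomorphic, only the square in \<open>B\<close> is
      differentiated and \<open>deriv Q\<close> drops out.\<close>
    moreover have "dir_deriv (\<lambda>y. dir_deriv \<xi> y 1) z 1 + dir_deriv (\<lambda>y. dir_deriv \<xi> y \<i>) z \<i>
        = - (8 * cnj z * (1 - z * cnj z) * cnj (Q z))"
      unfolding DD[OF z] by (simp add: power2_eq_square algebra_simps)
    ultimately show "dir_deriv (\<lambda>y. dir_deriv \<xi> y 1) z 1 + dir_deriv (\<lambda>y. dir_deriv \<xi> y \<i>) z \<i>
      + 4 * cnj z / of_real (1 - (cmod z)\<^sup>2) * (dir_deriv \<xi> z 1 + \<i> * dir_deriv \<xi> z \<i>) = 0"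
      by simp
  qed
qed


section \<open>Convolution with the Poisson kernel vector field\<close>

lemma continuous_on_cis_compose:
  assumes "continuous_on (sphere 0 1) f"
  shows "continuous_on S (\<lambda>t. f (cis t))"
  by (rule continuous_on_compose2[OF assms]) (auto intro: continuous_intros)

lemma circle_integral_cong:
  "(\<And>w. w \<in> sphere 0 1 \<Longrightarrow> f w = g w) \<Longrightarrow> circle_integral f = circle_integral g"
  unfolding circle_integral_def by (intro integral_cong) auto

lemma circle_integral_add:
  assumes "continuous_on (sphere 0 1) f" "continuous_on (sphere 0 1) g"
  shows "circle_integral (\<lambda>w. f w + g w) = circle_integral f + circle_integral g"
  unfolding circle_integral_def
  by (intro integral_add integrable_continuous_real continuous_on_cis_compose assms)

lemma circle_integral_cmult:
  "circle_integral (\<lambda>w. c * f w) = c * circle_integral f"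
  unfolding circle_integral_def by simp

lemma circle_integral_cnj:
  "circle_integral (\<lambda>w. cnj (f w)) = cnj (circle_integral f)"
  unfolding circle_integral_def by (simp add: integral_cnj)

lemma circle_integral_field_derivative:
  fixes G G' :: "complex \<Rightarrow> complex \<Rightarrow> complex"
  assumes G: "\<And>z w. z \<in> ball 0 1 \<Longrightarrow> w \<in> sphere 0 1 \<Longrightarrow>
      ((\<lambda>z. G z w) has_field_derivative G' z w) (at z)"
    and cont: "\<And>z. z \<in> ball 0 1 \<Longrightarrow> continuous_on (sphere 0 1) (G z)"
    and cont': "continuous_on (ball 0 1 \<times> sphere 0 1) (\<lambda>p. G' (fst p) (snd p))"
    and z: "z \<in> ball 0 1"
  shows "((\<lambda>z. circle_integral (G z)) has_field_derivative circle_integral (G' z)) (at z)"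
proof -
  have "((\<lambda>z. integral (cbox 0 (2 * pi)) (\<lambda>t. G z (cis t))) has_field_derivative
      integral (cbox 0 (2 * pi)) (\<lambda>t. G' z (cis t))) (at z within ball 0 1)"
  proof (rule leibniz_rule_field_derivative)
    show "((\<lambda>z. G z (cis t)) has_field_derivative G' z (cis t)) (at z within ball 0 1)"
      if "z \<in> ball 0 1" for z t
      using G[OF that, of "cis t"] by (simp add: has_field_derivative_at_within)
    show "(\<lambda>t. G z (cis t)) integrable_on cbox 0 (2 * pi)" if "z \<in> ball 0 1" for z
      by (intro integrable_continuous continuous_on_cis_compose cont that)
    show "continuous_on (ball 0 1 \<times> cbox 0 (2 * pi)) (\<lambda>(z, t). G' z (cis t))"
      unfolding case_prod_beta
      by (rule continuous_on_compose2[OF cont', where f = "\<lambda>p. (fst p, cis (snd p))", simplified])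
        (auto intro!: continuous_intros)
  qed (use z in auto)
  then show ?thesis
    by (simp add: circle_integral_def at_within_open[OF z])
qed

section \<open>The rotated kernel and its splitting\<close>

lemma circle_point_cnj: "w \<in> sphere 0 1 \<Longrightarrow> w * cnj w = 1"
  by (metis complex_norm_square mem_sphere_0 of_real_1 one_power2)

lemma one_minus_circle_nz:
  assumes "z \<in> ball 0 1" "w \<in> sphere 0 1"
  shows "1 - z * cnj w \<noteq> 0"
proof
  assume "1 - z * cnj w = 0"
  then have "cmod (z * cnj w) = 1"
    by simp
  then show False
    using assms by (simp add: norm_mult)
qed

text \<open>On the circle \<open>inverse w = cnj w\<close>, and the squared modulus in the
  denominator is a product of two conjugate factors. So the rotated kernel is rational in
  \<open>z\<close> and \<open>cnj z\<close>, with separate poles in each.\<close>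

lemma poisson_field_rotated:
  assumes z: "z \<in> ball 0 1" and w: "w \<in> sphere 0 1"
  shows "poisson_field (z * inverse w)
    = \<i> * (1 - z * cnj z) ^ 3 / ((1 - z * cnj w) * (1 - cnj z * w) ^ 3)"
proof -
  have i: "inverse w = cnj w"
    using circle_point_cnj[OF w] by (simp add: inverse_unique)
  have n: "cmod (z * cnj w) = cmod z"
    using w by (simp add: norm_mult)
  have "of_real ((cmod (1 - cnj (z * cnj w)))\<^sup>2) = (1 - cnj z * w) * (1 - z * cnj w)"
    unfolding complex_norm_square by simp
  then show ?thesis
    unfolding poisson_field_def i n of_real_power of_real_one_minus_norm
    by (simp add: power2_eq_square power3_eq_cube mult_ac)
qed

text \<open>The only term with a pole in \<open>a\<close> is free of \<open>b\<close>: it stems from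
  the integration constant. At \<open>b = 0\<close> both sides are
  \<open>1 / (1 - a) = 1 + a + a\<^sup>2 + a ^ 3 / (1 - a)\<close>.\<close>

lemma partial_fractions:
  fixes a b :: "'a::field"
  assumes "1 - a \<noteq> 0" "1 - b \<noteq> 0"
  shows "(1 - a * b) ^ 3 / ((1 - a) * (1 - b) ^ 3) = a ^ 3 * inverse (1 - a) + inverse (1 - b) ^ 3
    + a * (3 * (inverse (1 - b))\<^sup>2 - 2 * inverse (1 - b) ^ 3)
    + a\<^sup>2 * (inverse (1 - b) ^ 3 - 3 * (inverse (1 - b))\<^sup>2 + 3 * inverse (1 - b))"
proof -
  define x y where "x = inverse (1 - a)" and "y = inverse (1 - b)"
  have "x * (1 - a) = 1" "y * (1 - b) = 1"
    using assms by (auto simp: x_def y_def)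
  then have "(1 - a * b) ^ 3 * (x * y ^ 3) = a ^ 3 * x + y ^ 3 + a * (3 * y\<^sup>2 - 2 * y ^ 3)
      + a\<^sup>2 * (y ^ 3 - 3 * y\<^sup>2 + 3 * y)"
    by algebra
  then show ?thesis
    by (simp add: x_def y_def divide_inverse power_inverse)
qed

text \<open>
  In terms of \<open>a = z cnj w\<close> and \<open>b = cnj a\<close> the integrand is \<open>f w \<i> (1 - a b)\<^sup>3 / ((1 - a) (1 - b)\<^sup>3)\<close>, whose
  derivative in \<open>b\<close> is \<open>3 \<i> (1 - a b)\<^sup>2 / (1 - b)\<^sup>4\<close>. Expanding \<open>(1 - a b)\<^sup>2\<close> in powers of \<open>a\<close> and integrating in
  \<open>b\<close> gives the partial fractions above and thereby \<open>P\<^sub>0\<close>, \<open>P\<^sub>1\<close>, \<open>P\<^sub>2\<close>.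
\<close>

lemma circle_convolution_poisson_field_decomposition:
  fixes f :: "complex \<Rightarrow> real"
  assumes f: "continuous_on (sphere 0 1) f"
  obtains H P0 P1 P2 Q :: "complex \<Rightarrow> complex" where
    "H holomorphic_on ball 0 1"
    "\<And>z. z \<in> ball 0 1 \<Longrightarrow> (P0 has_field_derivative Q z) (at z)"
    "\<And>z. z \<in> ball 0 1 \<Longrightarrow> (P1 has_field_derivative - 2 * z * Q z) (at z)"
    "\<And>z. z \<in> ball 0 1 \<Longrightarrow> (P2 has_field_derivative z\<^sup>2 * Q z) (at z)"
    "\<And>z. z \<in> ball 0 1 \<Longrightarrow> circle_convolution f poisson_field z
      = H z + cnj (P0 z) + z * cnj (P1 z) + z\<^sup>2 * cnj (P2 z)"
proof -
  define c :: complex where "c = 1 / (2 * of_real pi)"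
  define y where "y z w = inverse (1 - z * cnj w)" for z w
  \<comment> \<open>The four partial fractions at \<open>a = z * cnj w\<close>, multiplied by
    \<open>f w * w * \<i>\<close> and simplified by \<open>w * cnj w = 1\<close>. The parts in
    \<open>cnj z\<close> are stored conjugated, to be holomorphic in \<open>z\<close>; hence the
    sign of \<i>, while the real \<open>f w\<close> is unaffected.\<close>
  define h where "h z w = of_real (f w) * (\<i> * (cnj w)\<^sup>2 * z ^ 3 * y z w)" for z w
  define h' where "h' z w = of_real (f w) * (\<i> * (cnj w)\<^sup>2
    * (3 * z\<^sup>2 * y z w + z ^ 3 * (cnj w * (y z w)\<^sup>2)))" for z w
  define p0 where "p0 z w = of_real (f w) * (- \<i> * cnj w * y z w ^ 3)" for z w
  define p1 where "p1 z w = of_real (f w) * (- \<i> * (3 * (y z w)\<^sup>2 - 2 * y z w ^ 3))" for z w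
  define p2 where "p2 z w = of_real (f w) * (- \<i> * w * (y z w ^ 3 - 3 * (y z w)\<^sup>2 + 3 * y z w))" for z w
  define q where "q z w = of_real (f w) * (- 3 * \<i> * (cnj w)\<^sup>2 * y z w ^ 4)" for z w
  define H where "H z = c * circle_integral (h z)" for z
  define P0 where "P0 z = c * circle_integral (p0 z)" for z
  define P1 where "P1 z = c * circle_integral (p1 z)" for z
  define P2 where "P2 z = c * circle_integral (p2 z)" for z
  define Q where "Q z = c * circle_integral (q z)" for z
  \<comment> \<open>Allows \<open>z * cnj w * y z w\<close> to be replaced by
    \<open>y z w - 1\<close>, which reconciles the derivatives of \<open>p1\<close> and
    \<open>p2\<close> with multiples of \<open>q\<close>.\<close>
  have y_unit: "y z w * (1 - z * cnj w) = 1" if "z \<in> ball 0 1" "w \<in> sphere 0 1" for z w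
    using one_minus_circle_nz[OF that] by (simp add: y_def)
  have y': "((\<lambda>z. y z w) has_field_derivative cnj w * (y z w)\<^sup>2) (at z)"
    if "z \<in> ball 0 1" "w \<in> sphere 0 1" for z w
    unfolding y_def using one_minus_circle_nz[OF that]
    by (auto intro!: derivative_eq_intros simp: power2_eq_square)
  have y2': "((\<lambda>z. (y z w)\<^sup>2) has_field_derivative 2 * (cnj w * y z w ^ 3)) (at z)"
    and y3': "((\<lambda>z. y z w ^ 3) has_field_derivative 3 * (cnj w * y z w ^ 4)) (at z)"
    if "z \<in> ball 0 1" "w \<in> sphere 0 1" for z w
    using DERIV_power[OF y'[OF that], of 2] DERIV_power[OF y'[OF that], of 3]
    by (simp_all add: eval_nat_numeral mult_ac)
  have cf: "continuous_on (ball 0 1 \<times> sphere 0 1) (\<lambda>p. complex_of_real (f (snd p)))"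
    using f by (intro continuous_intros continuous_on_compose2[OF f]) auto
  have cy: "continuous_on (ball 0 1 \<times> sphere 0 1) (\<lambda>p. y (fst p) (snd p))"
    unfolding y_def using one_minus_circle_nz by (intro continuous_intros) auto
  have slice: "continuous_on (sphere 0 1) (g z)"
    if "continuous_on (ball 0 1 \<times> sphere 0 1) (\<lambda>p. g (fst p) (snd p))" "z \<in> ball 0 1"
    for g :: "complex \<Rightarrow> complex \<Rightarrow> complex" and z
    by (rule continuous_on_compose2[OF that(1), where f = "\<lambda>w. (z, w)", simplified])
      (use that(2) in \<open>auto intro!: continuous_intros\<close>)
  have cont: "continuous_on (ball 0 1 \<times> sphere 0 1) (\<lambda>p. h (fst p) (snd p))"
    "continuous_on (ball 0 1 \<times> sphere 0 1) (\<lambda>p. h' (fst p) (snd p))"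
    "continuous_on (ball 0 1 \<times> sphere 0 1) (\<lambda>p. p0 (fst p) (snd p))"
    "continuous_on (ball 0 1 \<times> sphere 0 1) (\<lambda>p. p1 (fst p) (snd p))"
    "continuous_on (ball 0 1 \<times> sphere 0 1) (\<lambda>p. p2 (fst p) (snd p))"
    "continuous_on (ball 0 1 \<times> sphere 0 1) (\<lambda>p. q (fst p) (snd p))"
    unfolding h_def h'_def p0_def p1_def p2_def q_def by (intro continuous_intros cf cy)+
  \<comment> \<open>The factor \<open>s\<close> does not depend on \<open>w\<close> and can leave
    the integral. With \<open>s\<close> equal to \<open>1\<close>, \<open>- 2 * z\<close> and
    \<open>z\<^sup>2\<close>, the derivatives of \<open>P0\<close>, \<open>P1\<close>,
    \<open>P2\<close> all reduce to the integral of the same \<open>q\<close>.\<close>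
  have D: "((\<lambda>z. c * circle_integral (g z)) has_field_derivative
      c * circle_integral (\<lambda>w. s z * g' z w)) (at z)"
    if "\<And>z w. z \<in> ball 0 1 \<Longrightarrow> w \<in> sphere 0 1 \<Longrightarrow>
        ((\<lambda>z. g z w) has_field_derivative s z * g' z w) (at z)"
      and "continuous_on (ball 0 1 \<times> sphere 0 1) (\<lambda>p. g (fst p) (snd p))"
      and "continuous_on (ball 0 1 \<times> sphere 0 1) (\<lambda>p. g' (fst p) (snd p))"
      and "continuous_on UNIV s" and "z \<in> ball 0 1"
    for g g' :: "complex \<Rightarrow> complex \<Rightarrow> complex" and s z
  proof (intro DERIV_cmult circle_integral_field_derivative)
    show "continuous_on (ball 0 1 \<times> sphere 0 1) (\<lambda>p. s (fst p) * g' (fst p) (snd p))"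
      using that(3) by (intro continuous_intros continuous_on_compose2[OF that(4)]) auto
  qed (use that slice in auto)
  show thesis
  proof (rule that)
    have "((\<lambda>z. h z w) has_field_derivative 1 * h' z w) (at z)"
      if "z \<in> ball 0 1" "w \<in> sphere 0 1" for z w
      unfolding h_def h'_def by (rule derivative_eq_intros y'[OF that] refl)+ (simp add: algebra_simps)
    from D[OF this cont(1,2) continuous_on_const] show "H holomorphic_on ball 0 1"
      unfolding H_def holomorphic_on_open[OF open_ball] by blast
    fix z :: complex
    assume z: "z \<in> ball 0 1"
    have "((\<lambda>z. p0 z w) has_field_derivative 1 * q z w) (at z)"
      if zw: "z \<in> ball 0 1" "w \<in> sphere 0 1" for z w
    proof -
      have "((\<lambda>z. p0 z w) has_field_derivative
          of_real (f w) * (- \<i> * cnj w * (3 * (cnj w * y z w ^ 4)))) (at z)"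
        unfolding p0_def by (intro DERIV_cmult y3'[OF zw])
      then show ?thesis
        unfolding q_def by (simp add: power2_eq_square mult_ac)
    qed
    from D[OF this cont(3,6) continuous_on_const z] show "(P0 has_field_derivative Q z) (at z)"
      unfolding P0_def Q_def by simp
    have "((\<lambda>z. p1 z w) has_field_derivative - 2 * z * q z w) (at z)"
      if zw: "z \<in> ball 0 1" "w \<in> sphere 0 1" for z w
    proof -
      have "((\<lambda>z. p1 z w) has_field_derivative
          of_real (f w) * (- \<i> * (3 * (2 * (cnj w * y z w ^ 3)) - 2 * (3 * (cnj w * y z w ^ 4))))) (at z)"
        unfolding p1_def by (intro DERIV_cmult DERIV_diff y2'[OF zw] y3'[OF zw])
      also have "of_real (f w) * (- \<i> * (3 * (2 * (cnj w * y z w ^ 3)) - 2 * (3 * (cnj w * y z w ^ 4))))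
          = - 2 * z * q z w"
        unfolding q_def using y_unit[OF zw] by algebra
      finally show ?thesis .
    qed
    from D[OF this cont(4,6) continuous_on_mult_left[OF continuous_on_id] z]
    show "(P1 has_field_derivative - 2 * z * Q z) (at z)"
      unfolding P1_def Q_def circle_integral_cmult by (simp add: mult_ac)
    have "((\<lambda>z. p2 z w) has_field_derivative z\<^sup>2 * q z w) (at z)"
      if zw: "z \<in> ball 0 1" "w \<in> sphere 0 1" for z w
    proof -
      have "((\<lambda>z. p2 z w) has_field_derivative of_real (f w) * (- \<i> * w * (3 * (cnj w * y z w ^ 4)
          - 3 * (2 * (cnj w * y z w ^ 3)) + 3 * (cnj w * (y z w)\<^sup>2)))) (at z)"
        unfolding p2_def by (intro DERIV_cmult DERIV_diff DERIV_add y'[OF zw] y2'[OF zw] y3'[OF zw])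
      also have "of_real (f w) * (- \<i> * w * (3 * (cnj w * y z w ^ 4)
          - 3 * (2 * (cnj w * y z w ^ 3)) + 3 * (cnj w * (y z w)\<^sup>2))) = z\<^sup>2 * q z w"
        unfolding q_def using y_unit[OF zw] circle_point_cnj[OF zw(2)] by algebra
      finally show ?thesis .
    qed
    from D[OF this cont(5,6) continuous_on_power[OF continuous_on_id] z]
    show "(P2 has_field_derivative z\<^sup>2 * Q z) (at z)"
      unfolding P2_def Q_def circle_integral_cmult by (simp add: mult_ac)
    have "of_real (f w) * w * poisson_field (z * inverse w)
        = h z w + (cnj (p0 z w) + (z * cnj (p1 z w) + z\<^sup>2 * cnj (p2 z w)))" if w: "w \<in> sphere 0 1" for w
    proof -
      define a where "a = z * cnj w"
      have z_eq: "z = a * w"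
        using circle_point_cnj[OF w] by (simp add: a_def mult_ac)
      have a: "1 - a \<noteq> 0"
        using one_minus_circle_nz[OF z w] by (simp add: a_def)
      have b: "1 - cnj a \<noteq> 0"
        using a by (metis complex_cnj_diff complex_cnj_one complex_cnj_zero_iff)
      have "cnj z * w = cnj a" "z * cnj z = a * cnj a"
        using circle_point_cnj[OF w] unfolding a_def complex_cnj_mult complex_cnj_cnj
        by (simp, algebra)
      then have K: "poisson_field (z * inverse w) = \<i> * ((1 - a * cnj a) ^ 3 / ((1 - a) * (1 - cnj a) ^ 3))"
        unfolding poisson_field_rotated[OF z w] a_def[symmetric] by simp
      define V where "V = cnj (y z w)"
      have "inverse (1 - a) = y z w" "inverse (1 - cnj a) = V"
        by (simp_all add: V_def y_def a_def)
      note K = K[unfolded partial_fractions[OF a b], unfolded this]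
      have *: "cnj (p0 z w) = of_real (f w) * (\<i> * w * V ^ 3)"
        "cnj (p1 z w) = of_real (f w) * (\<i> * (3 * V\<^sup>2 - 2 * V ^ 3))"
        "cnj (p2 z w) = of_real (f w) * (\<i> * cnj w * (V ^ 3 - 3 * V\<^sup>2 + 3 * V))"
        by (simp_all add: p0_def p1_def p2_def V_def)
      show ?thesis
        unfolding K * h_def using circle_point_cnj[OF w] z_eq by algebra
    qed
    then have "circle_convolution f poisson_field z = c * circle_integral
        (\<lambda>w. h z w + (cnj (p0 z w) + (z * cnj (p1 z w) + z\<^sup>2 * cnj (p2 z w))))"
      unfolding circle_convolution_def c_def by (auto intro!: circle_integral_cong)
    also have "\<dots> = H z + cnj (P0 z) + z * cnj (P1 z) + z\<^sup>2 * cnj (P2 z)"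
    proof -
      have "cnj c = c"
        by (simp add: c_def)
      moreover have "circle_integral (\<lambda>w. h z w + (cnj (p0 z w) + (z * cnj (p1 z w) + z\<^sup>2 * cnj (p2 z w))))
          = circle_integral (h z) + (cnj (circle_integral (p0 z))
            + (z * cnj (circle_integral (p1 z)) + z\<^sup>2 * cnj (circle_integral (p2 z))))"
        using slice[OF cont(1) z] slice[OF cont(3) z] slice[OF cont(4) z] slice[OF cont(5) z]
        by (simp add: circle_integral_add circle_integral_cmult circle_integral_cnj
            continuous_on_add continuous_on_mult continuous_on_cnj continuous_on_const)
      ultimately show ?thesis
        unfolding H_def P0_def P1_def P2_def by (simp add: distrib_left mult_ac)
    qed
    finally show "circle_convolution f poisson_field z
        = H z + cnj (P0 z) + z * cnj (P1 z) + z\<^sup>2 * cnj (P2 z)" .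
  qed
qed

section \<open>Linearity of the convolution and the operator \<open>F\<close>\<close>

lemma circle_convolution_cong:
  "(\<And>w. w \<in> sphere 0 1 \<Longrightarrow> f w = g w) \<Longrightarrow> circle_convolution f K z = circle_convolution g K z"
  unfolding circle_convolution_def by (auto intro!: circle_integral_cong)

lemma circle_convolution_scale:
  "circle_convolution (\<lambda>w. a * f w) K z = of_real a * circle_convolution f K z"
  unfolding circle_convolution_def
  by (simp add: circle_integral_cmult[symmetric] mult_ac)

text \<open>Additivity of the integral asks for integrable summands. For \<open>z\<close> inside the
  disk the rational form of the kernel has no pole on the circle, so the integrands are
  continuous.\<close>

lemma circle_convolution_add:
  assumes "continuous_on (sphere 0 1) f" "continuous_on (sphere 0 1) g" and z: "z \<in> ball 0 1"
  shows "circle_convolution (\<lambda>w. f w + g w) poisson_field z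
    = circle_convolution f poisson_field z + circle_convolution g poisson_field z"
proof -
  have nz: "(1 - z * cnj w) * (1 - cnj z * w) ^ 3 \<noteq> 0" if "w \<in> sphere 0 1" for w
    using one_minus_circle_nz[OF z that]
    by (metis complex_cnj_cnj complex_cnj_diff complex_cnj_mult complex_cnj_one complex_cnj_zero_iff
        mult_eq_0_iff power_eq_0_iff)
  have "continuous_on (sphere 0 1) (\<lambda>w. \<i> * (1 - z * cnj z) ^ 3 / ((1 - z * cnj w) * (1 - cnj z * w) ^ 3))"
    using nz by (intro continuous_intros) auto
  then have "continuous_on (sphere 0 1) (\<lambda>w. poisson_field (z * inverse w))"
    by (rule continuous_on_eq) (simp only: poisson_field_rotated[OF z])
  then have "continuous_on (sphere 0 1) (\<lambda>w. of_real (h w) * w * poisson_field (z * inverse w))"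
    if "continuous_on (sphere 0 1) h" for h :: "complex \<Rightarrow> real"
    using that by (intro continuous_intros)
  from circle_integral_add[OF this[OF assms(1)] this[OF assms(2)]] show ?thesis
    unfolding circle_convolution_def of_real_add distrib_right by (simp only: distrib_left)
qed

theorem theorem4:
  shows "\<exists>F :: circle_field \<Rightarrow> disk_field.
    linear F \<and>
    (\<forall>(X :: circle_field) (f :: complex \<Rightarrow> real).
      continuous_on (sphere 0 1) f \<and>
      (\<forall>w\<in>sphere 0 1. circle_field_at X w = of_real (f w) * rotation_field w) \<longrightarrow>
      (\<forall>z\<in>ball 0 1. disk_field_at (F X) z = circle_convolution f poisson_field z)) \<and>
    (\<forall>X :: circle_field. harmonic_field_on (ball 0 1) (disk_field_at (F X)))"
proof -
  obtain c :: "circle_field \<Rightarrow> complex \<Rightarrow> real" where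
    c: "\<And>X. continuous_on (sphere 0 1) (c X)"
      "\<And>X. \<forall>w\<in>sphere 0 1. circle_field_at X w = of_real (c X w) * rotation_field w"
    using circle_field_coefficient(1) by metis
  define \<xi> where "\<xi> X z = (if z \<in> ball 0 1 then circle_convolution (c X) poisson_field z else 0)" for X z
  define F where "F X = Disk_field (\<xi> X)" for X
  have \<xi>: "\<And>k. Ck_on k (\<xi> X) (ball 0 1)" "harmonic_field_on (ball 0 1) (\<xi> X)" for X
  proof -
    obtain H P0 P1 P2 Q where d: "H holomorphic_on ball 0 1"
      "\<And>z. z \<in> ball 0 1 \<Longrightarrow> (P0 has_field_derivative Q z) (at z)"
      "\<And>z. z \<in> ball 0 1 \<Longrightarrow> (P1 has_field_derivative - 2 * z * Q z) (at z)"
      "\<And>z. z \<in> ball 0 1 \<Longrightarrow> (P2 has_field_derivative z\<^sup>2 * Q z) (at z)"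
      "\<And>z. z \<in> ball 0 1 \<Longrightarrow> circle_convolution (c X) poisson_field z
        = H z + cnj (P0 z) + z * cnj (P1 z) + z\<^sup>2 * cnj (P2 z)"
      using circle_convolution_poisson_field_decomposition[OF c(1)] by metis
    have e: "\<xi> X z = H z + cnj (P0 z) + z * cnj (P1 z) + z\<^sup>2 * cnj (P2 z)" if "z \<in> ball 0 1" for z
      using d(5)[OF that] that by (simp add: \<xi>_def)
    show "\<And>k. Ck_on k (\<xi> X) (ball 0 1)" "harmonic_field_on (ball 0 1) (\<xi> X)"
      by (rule harmonic_field_on_antiholomorphic[OF d(1-4) e]; assumption)+
  qed
  have F: "disk_field_at (F X) = \<xi> X" for X
    unfolding F_def using \<xi>(1)[of 0 X] by (intro Disk_field_inverse) (auto simp: \<xi>_def)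
  have "linear F"
  proof (rule linearI)
    fix X Y :: circle_field and a :: real
    \<comment> \<open>The chosen coefficients are arbitrary off the circle, so \<open>c\<close> is
      additive only on it, by uniqueness there. The convolution sees no other values.\<close>
    have "\<forall>w\<in>sphere 0 1. c (X + Y) w = c X w + c Y w"
      by (rule circle_field_coefficient(2)[OF c(2)])
        (use c(2) in \<open>auto simp: plus_circle_field.rep_eq distrib_right\<close>)
    then show "F (X + Y) = F X + F Y"
      by (intro disk_field_eqI) (auto simp: F plus_disk_field.rep_eq \<xi>_def
          circle_convolution_add[OF c(1) c(1), symmetric] intro!: circle_convolution_cong)
    have "\<forall>w\<in>sphere 0 1. c (a *\<^sub>R X) w = a * c X w"
      by (rule circle_field_coefficient(2)[OF c(2)])
        (use c(2) in \<open>auto simp: scaleR_circle_field.rep_eq scaleR_conv_of_real mult_ac\<close>)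
    then show "F (a *\<^sub>R X) = a *\<^sub>R F X"
      by (intro disk_field_eqI) (auto simp: F scaleR_disk_field.rep_eq \<xi>_def scaleR_conv_of_real
          circle_convolution_scale[symmetric] intro!: circle_convolution_cong)
  qed
  moreover have "disk_field_at (F X) z = circle_convolution f poisson_field z"
    if "\<forall>w\<in>sphere 0 1. circle_field_at X w = of_real (f w) * rotation_field w" "z \<in> ball 0 1" for X f z
    unfolding F \<xi>_def using circle_field_coefficient(2)[OF c(2) that(1)] that(2)
    by (auto intro: circle_convolution_cong)
  ultimately show ?thesis
    using \<xi>(2) F by (intro exI[of _ F]) auto
qed

end
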